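(* Let $u$ and $v$ be two words of the same length with the same Parikh vector. Suppose that either (a) all symbols of $u$ are pairwise distinct, or (b) $u$ and $v$ are over a binary alphabet. Then $v$ can be obtained from $u$ by applying a finite sequence of operations, each of which is either $\mathit{rot}$ or $\mathsf{BBWT}$.
   Context: Strings are over a totally ordered alphabet. The Parikh vector of a word records the number of occurrences of each symbol. $\mathit{rot}(x)=x[|x|]\,x[1..|x|-1]$. A Lyndon word is a nonempty string strictly lexicographically smaller than all its proper nonempty suffixes. Every string has a unique Lyndon factorization $w=u_1\cdots u_m$ into Lyndon words with $u_1\succeq\cdots\succeq u_m$. For primitive $x,y$, $x\prec_\omega y$ iff $x^\infty\prec y^\infty$ lexicographically. $\mathsf{BBWT}(w)$ is obtained as follows: take the multiset of all cyclic rotations of all Lyndon factors $u_j$ (each contributing its $|u_j|$ rotations), sort it in $\omega$-order, and concatenate the last characters. *)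

theory Defs
  imports Main "HOL-Library.Sublist" "HOL-Library.Multiset" "HOL-Library.Fun_Lexorder"
begin

definition parikh :: "'a list \<Rightarrow> 'a \<Rightarrow> nat" where
  "parikh w = (\<lambda>a. count_list w a)"

definition rot :: "'a list \<Rightarrow> 'a list" where
  "rot w = (if w = [] then [] else last w # butlast w)"

(* ord_class.lexordp is the strict lexicographic order in which a proper prefix is smaller. *)
definition lyndon :: "'a::linorder list \<Rightarrow> bool" where
  "lyndon w \<longleftrightarrow> w \<noteq> [] \<and> (\<forall>s. strict_suffix s w \<and> s \<noteq> [] \<longrightarrow> ord_class.lexordp w s)"

definition is_lyndon_factorization :: "'a::linorder list \<Rightarrow> 'a list list \<Rightarrow> bool" where
  "is_lyndon_factorization w us \<longleftrightarrow>
     concat us = w \<and> (\<forall>u\<in>set us. lyndon u) \<and> sorted_wrt (\<lambda>x y. ord_class.lexordp_eq y x) us"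

(* Well defined: every word has exactly one such factorization (Chen, Fox, Lyndon);
   that of the empty word is the empty list. *)
definition lyndon_factorization :: "'a::linorder list \<Rightarrow> 'a list list" where
  "lyndon_factorization w = (THE us. is_lyndon_factorization w us)"

(* The infinite power x x x ..., indexed from 0; only meaningful for nonempty x. *)
definition inf_power :: "'a list \<Rightarrow> nat \<Rightarrow> 'a" where
  "inf_power x = (\<lambda>i. x ! (i mod length x))"

definition omega_less :: "'a::linorder list \<Rightarrow> 'a list \<Rightarrow> bool" where
  "omega_less x y \<longleftrightarrow> less_fun (inf_power x) (inf_power y)"

(* The reflexive closure; a linear order on primitive words, for which equality of
   the infinite powers implies equality of the words. *)
definition omega_le :: "'a::linorder list \<Rightarrow> 'a list \<Rightarrow> bool" where
  "omega_le x y \<longleftrightarrow> omega_less x y \<or> x = y"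

definition lyndon_rotations :: "'a::linorder list \<Rightarrow> 'a list multiset" where
  "lyndon_rotations w =
     mset (concat (map (\<lambda>u. map (\<lambda>i. rotate i u) [0..<length u]) (lyndon_factorization w)))"

(* Lyndon words and hence their rotations are primitive, so there is exactly one
   omega-sorted list containing these rotations with the right multiplicities. *)
definition bbwt :: "'a::linorder list \<Rightarrow> 'a list" where
  "bbwt w = map last (THE xs. mset xs = lyndon_rotations w \<and> sorted_wrt omega_le xs)"

end

theory Submission
  imports Defs "HOL-Combinatorics.Cycles" "HOL-Library.Product_Lexorder"
begin

text \<open>
  The transform is inverted by the standard permutation \<open>\<sigma>\<close> of a word \<open>P\<close>, which sends \<open>j\<close> to the
  position in \<open>P\<close> of the \<open>j\<close>-th entry of its stable sort: reading the cycles of \<open>\<sigma>\<close> from their minima,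
  by decreasing minimum, spells a preimage of \<open>P\<close>. Hence \<open>bbwt\<close>, like \<open>rot\<close>, permutes the finite set
  of words with a given Parikh vector, and reachability is symmetric on it.

  It remains to reach every word from its sorted word \<open>s\<close>. If \<open>P\<close> is a letter \<open>y\<close> followed by the
  prefix of \<open>s\<close> of length \<open>r\<close>, all of whose letters are below \<open>y\<close>, then \<open>\<sigma>\<close> maps
  \<open>0, 1, \<dots>, r - 1\<close> to \<open>1, 2, \<dots>, r\<close>, so the preimage of \<open>P\<close> contains the prefix of \<open>s\<close> of
  length \<open>r + 1\<close>. If the letters are distinct or there are only two of them, each word with a
  rotation starting with the prefix of length \<open>r\<close> has a rotation of this shape or one starting
  with a longer prefix of \<open>s\<close>, and induction on \<open>r\<close> downwards applies.
\<close>

section \<open>Lexicographic order and infinite powers\<close>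

lemma lexordp_nthI:
  fixes u v :: "'a::linorder list"
  assumes "i < length u" "i < length v" "u ! i < v ! i" "\<And>j. j < i \<Longrightarrow> u ! j = v ! j"
  shows "ord_class.lexordp u v"
proof -
  have "take i u = take i v"
    using assms by (intro nth_equalityI) auto
  then show ?thesis
    using id_take_nth_drop[OF assms(1)] id_take_nth_drop[OF assms(2)]
      lexordp_append_left_rightI[OF assms(3)] by metis
qed

lemma inf_power_nth: "i < length u \<Longrightarrow> inf_power u i = u ! i"
  by (simp add: inf_power_def)

lemma inf_power_periodic: "inf_power u (length u + i) = inf_power u i"
  by (simp add: inf_power_def)

text \<open>The first mismatch of \<open>inf_power u\<close> with its shift by \<open>k\<close>
  decides the comparison of \<open>u\<close> with \<open>drop k u\<close> if it lies within that
  suffix. Otherwise the suffix is a border of \<open>u\<close>, and minimality fails for another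
  shift.\<close>

lemma lyndon_if_strictly_minimal:
  fixes u :: "'a::linorder list"
  assumes "u \<noteq> []"
    and min: "\<And>k. 0 < k \<Longrightarrow> k < length u \<Longrightarrow> less_fun (inf_power u) (\<lambda>i. inf_power u (k + i))"
  shows "lyndon u"
  unfolding lyndon_def
proof (intro conjI allI impI)
  fix s assume s: "strict_suffix s u \<and> s \<noteq> []"
  define k where "k = length u - length s"
  define x where "x = inf_power u"
  have len: "length s < length u" using s by (simp add: suffix_length_less)
  then have k: "0 < k" "k < length u" using s by (auto simp: k_def intro: diff_less)
  have sd: "s = drop k u"
    using s by (auto simp: k_def strict_suffix_def suffix_def)
  obtain t where t: "x t < x (k + t)" "\<And>j. j < t \<Longrightarrow> x j = x (k + j)"
    using min[OF k] by (auto simp: x_def elim!: less_funE)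
  have sx: "s ! i = x (k + i)" if "i < length s" for i
    using that k sd by (simp add: x_def inf_power_nth)
  show "ord_class.lexordp u s"
  proof (cases "t < length s")
    case True
    then show ?thesis
      using len t sx by (intro lexordp_nthI[of t]) (auto simp: inf_power_nth x_def)
  next
    case False
    \<comment> \<open>Then \<open>s\<close> is a border of \<open>u\<close>, and rotating \<open>u\<close> by \<open>length s\<close> yields a smaller rotation.\<close>
    define d where "d = length s"
    have d: "0 < d" "d < length u" "k + d = length u"
      using s len k by (auto simp: d_def k_def)
    have shift: "x (k + (d + i)) = x i" for i
      using d inf_power_periodic[of u i] by (simp add: x_def add.assoc[symmetric])
    \<comment> \<open>As \<open>k + d\<close> is a period of \<open>x\<close>, the mismatch at
      \<open>t\<close> with the shift by \<open>k\<close> becomes one at \<open>t - d\<close> with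
      the shift by \<open>d\<close>, in the opposite direction.\<close>
    have "less_fun (\<lambda>i. x (d + i)) x"
    proof (intro less_funI exI[of _ "t - d"] conjI allI impI)
      have "d \<le> t" using False d_def by simp
      then show "x (d + (t - d)) < x (t - d)" using t(1) shift[of "t - d"] by simp
      fix j assume "j < t - d"
      then show "x (d + j) = x j" using t(2)[of "d + j"] shift[of j] by simp
    qed
    then show ?thesis using min[OF d(1,2)] less_fun_asym unfolding x_def by blast
  qed
qed fact

text \<open>Either the first mismatch lies in both words, or \<open>u\<close> is a prefix of
  \<open>v\<close>, or \<open>v\<close> is a proper prefix of \<open>u\<close>. In the last case the
  period of \<open>v\<close> persists in \<open>inf_power u\<close> up to the mismatch, so the shift
  by \<open>length v\<close> is smaller, against \<open>min\<close>.\<close>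

lemma lexordp_eq_if_less_fun_inf_power:
  fixes u v :: "'a::linorder list"
  assumes "u \<noteq> []" "v \<noteq> []"
    and min: "\<And>k. 0 < k \<Longrightarrow> k < length u \<Longrightarrow> less_fun (inf_power u) (\<lambda>i. inf_power u (k + i))"
    and less: "less_fun (inf_power u) (inf_power v)"
  shows "ord_class.lexordp_eq u v"
proof -
  define x y where "x = inf_power u" and "y = inf_power v"
  obtain t where t: "x t < y t" "\<And>j. j < t \<Longrightarrow> x j = y j"
    using less by (auto simp: x_def y_def elim!: less_funE)
  have ux: "u ! i = x i" if "i < length u" for i using that by (simp add: x_def inf_power_nth)
  have vy: "v ! i = y i" if "i < length v" for i using that by (simp add: y_def inf_power_nth)
  consider "t < length u" "t < length v" | "length u \<le> t" "length u \<le> length v"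
    | "length v \<le> t" "length v < length u" by linarith
  then show ?thesis
  proof cases
    case 1
    then have "ord_class.lexordp u v"
      using t ux vy by (intro lexordp_nthI[of t]) auto
    then show ?thesis by (rule lexordp_into_lexordp_eq)
  next
    case 2
    then have "u = take (length u) v"
      using t ux vy by (intro nth_equalityI) auto
    then show ?thesis by (metis append_take_drop_id lexordp_eq_pref)
  next
    case 3
    have "0 < length v" using assms(2) by simp
    then have "t - length v < t" using 3 by linarith
    have "less_fun (\<lambda>i. x (length v + i)) x"
    proof (intro less_funI exI[of _ "t - length v"] conjI allI impI)
      show "x (length v + (t - length v)) < x (t - length v)"
        using t(1) t(2)[OF \<open>t - length v < t\<close>] 3 inf_power_periodic[of v "t - length v"]
        by (simp add: y_def)
      fix j assume "j < t - length v"
      then show "x (length v + j) = x j"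
        using t(2)[of "length v + j"] t(2)[of j] inf_power_periodic[of v j] by (simp add: y_def)
    qed
    then show ?thesis
      using min[of "length v"] 3 assms(2) less_fun_asym unfolding x_def by blast
  qed
qed

section \<open>Uniqueness of the Lyndon factorization\<close>

lemma lyndon_le_suffix:
  assumes "lyndon u" "suffix s u" "s \<noteq> []"
  shows "ord_class.lexordp_eq u s"
proof (cases "s = u")
  case True then show ?thesis by (simp add: lexordp_eq_refl)
next
  case False
  then have "strict_suffix s u" using assms(2) by (simp add: strict_suffix_def)
  then show ?thesis using assms unfolding lyndon_def by (blast intro: lexordp_into_lexordp_eq)
qed

text \<open>A suffix \<open>s\<close> reaching into the first factor \<open>a\<close> begins with a
  nonempty suffix \<open>s'\<close> of \<open>a\<close>, and then
  \<open>u \<le> a \<le> s' \<le> s\<close>. Thus the last factor is determined by the word, as its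
  least nonempty suffix.\<close>

lemma last_factor_le_suffix:
  assumes "sorted_wrt (\<lambda>x y. ord_class.lexordp_eq y x) (us @ [u])" "\<forall>x\<in>set (us @ [u]). lyndon x"
    and "suffix s (concat (us @ [u]))" "s \<noteq> []"
  shows "ord_class.lexordp_eq u s"
  using assms
proof (induction us)
  case Nil
  then show ?case by (simp add: lyndon_le_suffix)
next
  case (Cons a us)
  show ?case
  proof (cases "suffix s (concat (us @ [u]))")
    case True
    then show ?thesis using Cons by simp
  next
    case False
    then obtain s' where s': "s = s' @ concat (us @ [u])" "suffix s' a"
      using Cons.prems(3) by (auto simp: suffix_append)
    have "s' \<noteq> []" using s' False by auto
    then have "ord_class.lexordp_eq a s'" using s' Cons.prems(2) by (intro lyndon_le_suffix) auto
    moreover have "ord_class.lexordp_eq u a" using Cons.prems(1) by simp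
    moreover have "ord_class.lexordp_eq s' s" using s' by (simp add: lexordp_eq_pref)
    ultimately show ?thesis by (meson lexordp_eq_trans)
  qed
qed

text \<open>The last factors of both factorizations are suffixes of the same word, so each is at
  most the other; they are equal and can be cancelled.\<close>

lemma lyndon_factorization_unique:
  assumes "is_lyndon_factorization w us" "is_lyndon_factorization w vs"
  shows "us = vs"
  using assms
proof (induction us arbitrary: w vs rule: rev_induct)
  case Nil
  then have "concat vs = []" "\<forall>v\<in>set vs. v \<noteq> []"
    by (auto simp: is_lyndon_factorization_def lyndon_def)
  then show ?case by (metis concat_eq_Nil_conv last_in_set)
next
  case (snoc u us)
  have u: "concat (us @ [u]) = w" "\<forall>x\<in>set (us @ [u]). lyndon x"
    "sorted_wrt (\<lambda>x y. ord_class.lexordp_eq y x) (us @ [u])"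
    using snoc.prems by (auto simp: is_lyndon_factorization_def)
  have v: "concat vs = w" "\<forall>x\<in>set vs. lyndon x" "sorted_wrt (\<lambda>x y. ord_class.lexordp_eq y x) vs"
    using snoc.prems by (auto simp: is_lyndon_factorization_def)
  have "u \<noteq> []" using u by (auto simp: lyndon_def)
  then have "vs \<noteq> []" using u v by auto
  then obtain v' vs' where vs: "vs = vs' @ [v']" by (metis rev_exhaust)
  have "v' \<noteq> []" using v vs by (auto simp: lyndon_def)
  have w: "concat (us @ [u]) = concat (vs' @ [v'])" using u v vs by simp
  have "suffix v' (concat (us @ [u]))" unfolding w by (auto simp: suffix_def)
  then have "ord_class.lexordp_eq u v'"
    using u \<open>v' \<noteq> []\<close> by (intro last_factor_le_suffix[of us u])
  moreover have "suffix u (concat (vs' @ [v']))" unfolding w[symmetric] by (auto simp: suffix_def)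
  then have "ord_class.lexordp_eq v' u"
    using v vs \<open>u \<noteq> []\<close> by (intro last_factor_le_suffix[of vs' v']) auto
  ultimately have [simp]: "v' = u" by (simp add: lexordp_eq_antisym)
  have "is_lyndon_factorization (concat us) us" "is_lyndon_factorization (concat us) vs'"
    using u v vs by (auto simp: is_lyndon_factorization_def sorted_wrt_append)
  then show ?case using snoc.IH vs by simp
qed

lemma lyndon_factorization_eqI:
  "is_lyndon_factorization w us \<Longrightarrow> lyndon_factorization w = us"
  unfolding lyndon_factorization_def using lyndon_factorization_unique by blast

section \<open>Uniqueness of the \<omega>-sorted list\<close>

lemma omega_le_antisym: "omega_le x y \<Longrightarrow> omega_le y x \<Longrightarrow> x = y"
  unfolding omega_le_def omega_less_def using less_fun_asym by blast

lemma sorted_wrt_omega_le_unique: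
  assumes "mset xs = mset ys" "sorted_wrt omega_le xs" "sorted_wrt omega_le ys"
  shows "xs = ys"
  using assms
proof (induction xs arbitrary: ys)
  case Nil then show ?case by simp
next
  case (Cons x xs)
  then obtain y ys' where ys: "ys = y # ys'" by (cases ys) auto
  have "set (x # xs) = set (y # ys')" using Cons.prems(1) ys by (metis mset_eq_setD)
  moreover have "\<forall>z\<in>set (x # xs). omega_le x z" "\<forall>z\<in>set (y # ys'). omega_le y z"
    using Cons.prems ys by (auto simp: omega_le_def)
  ultimately have "x = y" by (metis list.set_intros(1) omega_le_antisym)
  then show ?case using Cons ys by simp
qed

lemma bbwt_eqI:
  assumes "mset xs = lyndon_rotations w" "sorted_wrt omega_le xs"
  shows "bbwt w = map last xs"
proof -
  have "(THE xs. mset xs = lyndon_rotations w \<and> sorted_wrt omega_le xs) = xs"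
    
    using assms by (intro the_equality) (auto intro: sorted_wrt_omega_le_unique)
  then show ?thesis by (simp add: bbwt_def)
qed

section \<open>Traces of a stable permutation\<close>

text \<open>Abstracts the standard permutation from its word: \<open>L\<close> reads the sorted
  word, and the order arguments on orbits rest on monotonicity and stability.\<close>

locale stable_permutation =
  fixes n :: nat and L :: "nat \<Rightarrow> 'a::linorder" and \<sigma> :: "nat \<Rightarrow> nat"
  assumes permutes: "\<sigma> permutes {..<n}"
    and mono: "i \<le> j \<Longrightarrow> j < n \<Longrightarrow> L i \<le> L j"
    and stable: "i < j \<Longrightarrow> j < n \<Longrightarrow> L i = L j \<Longrightarrow> \<sigma> i < \<sigma> j"
begin

text \<open>Row \<open>i\<close> of the \<open>\<omega>\<close>-sorted matrix of rotations, repeated forever.\<close>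

definition trace :: "nat \<Rightarrow> nat \<Rightarrow> 'a" where
  "trace i k = L ((\<sigma> ^^ k) i)"

lemma permutation: "permutation \<sigma>"
  using permutes by (auto simp: permutation_permutes)

lemma funpow_less: "i < n \<Longrightarrow> (\<sigma> ^^ k) i < n"
  using permutes_in_image[OF permutes_funpow[OF permutes]] by simp

lemma trace_funpow: "trace ((\<sigma> ^^ m) i) k = trace i (m + k)"
  by (simp add: trace_def funpow_add[symmetric] add.commute flip: comp_apply[of "\<sigma> ^^ k"])

text \<open>While the letters read along both orbits agree, stability preserves the order of the
  indices.\<close>

lemma funpow_mono_if_trace_eq:
  assumes "i < j" "j < n" "\<And>t. t < k \<Longrightarrow> trace i t = trace j t"
  shows "(\<sigma> ^^ k) i < (\<sigma> ^^ k) j"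
  using assms(3)
proof (induction k)
  case 0 then show ?case using assms by simp
next
  case (Suc k)
  then have "(\<sigma> ^^ k) i < (\<sigma> ^^ k) j" "L ((\<sigma> ^^ k) i) = L ((\<sigma> ^^ k) j)"
    by (auto simp: trace_def)
  then show ?case using stable funpow_less[OF assms(2), of k] by simp
qed

text \<open>At the first disagreement the indices are still in their original order, and
  \<open>L\<close> is monotone.\<close>

lemma trace_mono:
  assumes "i < j" "j < n"
  shows "trace i = trace j \<or> less_fun (trace i) (trace j)"
proof (cases "trace i = trace j")
  case False
  then have ex: "\<exists>k. trace i k \<noteq> trace j k" by auto
  define k where "k = (LEAST k. trace i k \<noteq> trace j k)"
  have k: "trace i k \<noteq> trace j k" "\<And>t. t < k \<Longrightarrow> trace i t = trace j t"
    using LeastI_ex[OF ex] not_less_Least unfolding k_def by auto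
  have "(\<sigma> ^^ k) i < (\<sigma> ^^ k) j" using funpow_mono_if_trace_eq[OF assms] k by blast
  then have "trace i k \<le> trace j k"
    unfolding trace_def using mono funpow_less[OF assms(2)] by simp
  then have "trace i k < trace j k" using k(1) by simp
  then show ?thesis using k(2) less_fun_def by blast
qed simp

text \<open>Otherwise the powers of \<open>\<sigma> ^^ m\<close> would move \<open>i\<close> strictly monotonically for ever. This gives
  the primitivity of the rows.\<close>

lemma fixed_if_trace_eq:
  assumes "i < n" "trace ((\<sigma> ^^ m) i) = trace i"
  shows "(\<sigma> ^^ m) i = i"
proof (rule ccontr)
  define \<tau> where "\<tau> = \<sigma> ^^ m"
  assume "(\<sigma> ^^ m) i \<noteq> i"
  have less: "(\<tau> ^^ k) i < n" for k
    unfolding \<tau>_def funpow_mult by (rule funpow_less[OF assms(1)])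
  have step: "(\<tau> ^^ k) a < (\<tau> ^^ k) b"
    if "a < b" "b < n" "trace a = trace b" for a b k
    unfolding \<tau>_def funpow_mult using that by (intro funpow_mono_if_trace_eq) auto
  consider "i < \<tau> i" | "\<tau> i < i" using \<open>(\<sigma> ^^ m) i \<noteq> i\<close> \<tau>_def by fastforce
  then show False
  proof cases
    case 1
    then have "(\<tau> ^^ k) i < (\<tau> ^^ k) (\<tau> i)" for k
      using step[of i "\<tau> i" k] assms less[of 1] by (auto simp: \<tau>_def)
    then have "k \<le> (\<tau> ^^ k) i" for k
      by (induction k) (auto simp: funpow_swap1 Suc_le_eq intro: le_less_trans)
    then show False using less[of n] by (meson not_le)
  next
    case 2
    then have dec: "(\<tau> ^^ k) (\<tau> i) < (\<tau> ^^ k) i" for k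
      using step[of "\<tau> i" i k] assms by (auto simp: \<tau>_def)
    \<comment> \<open>The iterates fall by at least one per step, so \<open>Suc i\<close> steps are
      impossible.\<close>
    have "(\<tau> ^^ k) i + k \<le> i" for k
    proof (induction k)
      case (Suc k)
      then show ?case using dec[of k] by (simp add: funpow_swap1)
    qed simp
    from this[of "Suc i"] show False by simp
  qed
qed

text \<open>The cycle length of \<open>i\<close> is a period of the common trace, and
  \<open>fixed_if_trace_eq\<close> turns a period of the trace of \<open>j\<close> into a return of
  \<open>j\<close> itself.\<close>

lemma least_power_dvd_if_trace_eq:
  assumes "j < n" "trace i = trace j"
  shows "least_power \<sigma> j dvd least_power \<sigma> i"
proof -
  let ?m = "least_power \<sigma> i"
  have "trace ((\<sigma> ^^ ?m) j) = trace j"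
  proof
    fix k
    have "trace ((\<sigma> ^^ ?m) j) k = trace ((\<sigma> ^^ ?m) i) k"
      using assms(2) by (simp add: trace_funpow)
    then show "trace ((\<sigma> ^^ ?m) j) k = trace j k"
      using least_power_of_permutation(1)[OF permutation, of i] assms(2) by simp
  qed
  then have "(\<sigma> ^^ ?m) j = j" by (rule fixed_if_trace_eq[OF assms(1)])
  then show ?thesis by (rule least_power_minimal)
qed

section \<open>Rows and their rotations\<close>

text \<open>\<open>support\<close> lists one full turn of the cycle from \<open>i\<close>, so the
  infinite power of the row is the trace of \<open>i\<close>.\<close>

definition row :: "nat \<Rightarrow> 'a list" where
  "row i = map L (support \<sigma> i)"

lemma length_row: "length (row i) = least_power \<sigma> i"
  by (simp add: row_def)

lemma row_nonempty: "row i \<noteq> []"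
  using least_power_of_permutation(2)[OF permutation, of i] by (simp add: row_def)

lemma funpow_mod_least_power: "(\<sigma> ^^ (k mod least_power \<sigma> i)) i = (\<sigma> ^^ k) i"
  using least_power_of_permutation(1)[OF permutation, of i] by (rule funpow_mod_eq)

lemma inf_power_row: "inf_power (row i) = trace i"
proof
  fix k
  have "k mod least_power \<sigma> i < least_power \<sigma> i"
    using least_power_of_permutation(2)[OF permutation, of i] by simp
  then show "inf_power (row i) k = trace i k"
    by (simp add: inf_power_def row_def trace_def funpow_mod_least_power)
qed

lemma row_eq_if_trace_eq:
  assumes "i < n" "j < n" "trace i = trace j"
  shows "row i = row j"
proof -
  have "least_power \<sigma> i = least_power \<sigma> j"
    using assms by (simp add: dvd_antisym least_power_dvd_if_trace_eq)
  moreover have "L ((\<sigma> ^^ k) i) = L ((\<sigma> ^^ k) j)" for k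
    using fun_cong[OF assms(3), of k] by (simp add: trace_def)
  ultimately show ?thesis by (simp add: row_def)
qed

lemma row_mono:
  assumes "i < j" "j < n"
  shows "omega_le (row i) (row j)"
  using trace_mono[OF assms] row_eq_if_trace_eq[of i j] assms
  by (auto simp: omega_le_def omega_less_def inf_power_row)

lemma sorted_rows: "sorted_wrt omega_le (map row [0..<n])"
  by (simp add: sorted_wrt_iff_nth_less row_mono)

lemma least_power_funpow: "least_power \<sigma> ((\<sigma> ^^ k) i) = least_power \<sigma> i"
proof (rule dvd_antisym)
  let ?p = "least_power \<sigma>"
  have swap: "(\<sigma> ^^ m) ((\<sigma> ^^ k) i) = (\<sigma> ^^ k) ((\<sigma> ^^ m) i)" for m
    by (metis add.commute comp_apply funpow_add)
  show "?p ((\<sigma> ^^ k) i) dvd ?p i"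
    by (rule least_power_minimal) (simp add: swap least_power_of_permutation(1)[OF permutation])
  have "(\<sigma> ^^ k) ((\<sigma> ^^ ?p ((\<sigma> ^^ k) i)) i) = (\<sigma> ^^ k) i"
    using least_power_of_permutation(1)[OF permutation, of "(\<sigma> ^^ k) i"] by (simp add: swap)
  then have "(\<sigma> ^^ ?p ((\<sigma> ^^ k) i)) i = i"
    using inj_fn[OF permutes_inj[OF permutes], of k] by (simp add: inj_eq)
  then show "?p i dvd ?p ((\<sigma> ^^ k) i)" by (rule least_power_minimal)
qed

lemma rotate_row: "rotate k (row i) = row ((\<sigma> ^^ k) i)"
proof (intro nth_equalityI)
  fix m assume m: "m < length (rotate k (row i))"
  then have m': "m < least_power \<sigma> i" by (simp add: length_row)
  then have "(k + m) mod least_power \<sigma> i < least_power \<sigma> i" by simp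
  then have "rotate k (row i) ! m = L ((\<sigma> ^^ (k + m)) i)"
    using m' by (simp add: nth_rotate length_row) (simp add: row_def funpow_mod_least_power)
  also have "\<dots> = row ((\<sigma> ^^ k) i) ! m"
    using m' by (simp add: row_def least_power_funpow) (metis add.commute comp_apply funpow_add)
  finally show "rotate k (row i) ! m = row ((\<sigma> ^^ k) i) ! m" .
qed (simp add: length_row least_power_funpow)

text \<open>One rotation moves the head \<open>L i\<close> of \<open>row i\<close> to the end. This
  lets the last column recover the original word.\<close>

lemma last_row: "last (row (\<sigma> i)) = L i"
proof -
  have "row (\<sigma> i) = rotate 1 (row i)" by (simp only: rotate_row) simp
  moreover have "row i = L i # tl (row i)"
    using least_power_of_permutation(2)[OF permutation, of i] by (simp add: row_def upt_conv_Cons)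
  ultimately show ?thesis by (metis One_nat_def last_snoc rotate1.simps(2) rotate_Suc rotate0 id_apply)
qed

section \<open>Decomposition into cycles\<close>

text \<open>One start per cycle: its least index carries the \<omega>-least rotation, hence a Lyndon
  word.\<close>

definition cycle_mins :: "nat list" where
  "cycle_mins = filter (\<lambda>i. \<forall>k. i \<le> (\<sigma> ^^ k) i) [0..<n]"

definition cycles :: "nat list list" where
  "cycles = map (support \<sigma>) (rev cycle_mins)"

lemma funpow_eq_iff_support: "(\<exists>k. j = (\<sigma> ^^ k) i) \<longleftrightarrow> j \<in> set (support \<sigma> i)"
  using support_set[OF permutation, of i] by auto

lemma set_support_less: "i < n \<Longrightarrow> set (support \<sigma> i) \<subseteq> {..<n}"
  using funpow_less by auto

lemma ex_funpow_inverse: "\<exists>l. (\<sigma> ^^ l) ((\<sigma> ^^ k) i) = i"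
proof -
  have "i \<in> set (support \<sigma> i)"
    using funpow_eq_iff_support[of i i] by (metis funpow_0)
  moreover have "(\<sigma> ^^ k) i \<in> set (support \<sigma> i)"
    using funpow_eq_iff_support by blast
  ultimately have "i \<in> set (support \<sigma> ((\<sigma> ^^ k) i))"
    using disjoint_support'[OF permutation] by (metis disjoint_iff)
  then show ?thesis by (metis funpow_eq_iff_support)
qed

lemma set_concat_cycles: "set (concat cycles) = {..<n}"
proof
  show "set (concat cycles) \<subseteq> {..<n}"
    using set_support_less by (fastforce simp: cycles_def cycle_mins_def)
  show "{..<n} \<subseteq> set (concat cycles)"
  proof
    fix j assume j: "j \<in> {..<n}"
    define i where "i = (LEAST i. \<exists>k. i = (\<sigma> ^^ k) j)"
    obtain k where k: "i = (\<sigma> ^^ k) j" 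
      using LeastI_ex[of "\<lambda>i. \<exists>k. i = (\<sigma> ^^ k) j"] i_def by blast
    have "i \<le> (\<sigma> ^^ l) i" for l
    proof -
      have "(\<sigma> ^^ l) i = (\<sigma> ^^ (l + k)) j" by (simp add: k funpow_add)
      then show ?thesis unfolding i_def by (intro Least_le) blast
    qed
    then have "i \<in> set cycle_mins" using j k funpow_less by (simp add: cycle_mins_def)
    moreover have "j \<in> set (support \<sigma> i)"
      using ex_funpow_inverse[of k j] k by (metis funpow_eq_iff_support)
    ultimately show "j \<in> set (concat cycles)" by (auto simp: cycles_def)
  qed
qed

text \<open>Two starts in the same cycle are iterates of each other, so minimality bounds each by
  the other.\<close>

lemma distinct_concat_supports:
  assumes "distinct is" "\<And>i k. i \<in> set is \<Longrightarrow> i \<le> (\<sigma> ^^ k) i"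
  shows "distinct (concat (map (support \<sigma>) is))"
  using assms
proof (induction "is")
  case (Cons i "is")
  have "set (support \<sigma> i) \<inter> set (support \<sigma> j) = {}" if "j \<in> set is" for j
  proof (rule ccontr)
    assume "set (support \<sigma> i) \<inter> set (support \<sigma> j) \<noteq> {}"
    then obtain k where k: "i = (\<sigma> ^^ k) j"
      using disjoint_support'[OF permutation] funpow_eq_iff_support by blast
    obtain l where "(\<sigma> ^^ l) i = j" using ex_funpow_inverse k by blast
    then have "i = j" using Cons.prems(2) that k by (metis antisym list.set_intros)
    then show False using Cons.prems(1) that by simp
  qed
  moreover have "distinct (support \<sigma> i)" using cycle_of_permutation[OF permutation] by simp
  ultimately show ?case using Cons by (simp add: disjoint_iff)
qed simp

lemma mset_concat_cycles: "mset (concat cycles) = mset [0..<n]"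
proof -
  have "distinct (concat cycles)"
    unfolding cycles_def by (rule distinct_concat_supports) (auto simp: cycle_mins_def)
  then show ?thesis
    using set_concat_cycles by (metis atLeast0LessThan distinct_upt set_eq_iff_mset_eq_distinct set_upt)
qed

section \<open>The Lyndon factorization spelled by the cycles\<close>

text \<open>A least index has a least trace in its cycle. A tie would force a return to
  \<open>i\<close> before the full cycle length.\<close>

lemma strictly_minimal_row:
  assumes "i \<in> set cycle_mins" "0 < k" "k < length (row i)"
  shows "less_fun (inf_power (row i)) (\<lambda>j. inf_power (row i) (k + j))"
proof -
  have i: "i < n" "i \<le> (\<sigma> ^^ k) i" using assms(1) by (auto simp: cycle_mins_def)
  have "(\<sigma> ^^ k) i \<noteq> i"
    using assms(2,3) least_power_le[of k \<sigma> i] by (auto simp: length_row)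
  then have "less_fun (trace i) (trace ((\<sigma> ^^ k) i))"
    using trace_mono[of i "(\<sigma> ^^ k) i"] fixed_if_trace_eq[of i k] funpow_less i by fastforce
  moreover have "trace ((\<sigma> ^^ k) i) = (\<lambda>j. trace i (k + j))"
    by (simp add: fun_eq_iff trace_funpow)
  ultimately show ?thesis by (simp add: inf_power_row)
qed

text \<open>Rows read from cycle minima are Lyndon words and grow weakly with the minimum; reversing
  \<open>cycle_mins\<close> makes the factors non-increasing.\<close>

lemma is_lyndon_factorization_rows:
  "is_lyndon_factorization (map L (concat cycles)) (map row (rev cycle_mins))"
  unfolding is_lyndon_factorization_def
proof (intro conjI ballI)
  show "concat (map row (rev cycle_mins)) = map L (concat cycles)"
    by (simp add: cycles_def map_concat row_def[abs_def] comp_def)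
  show "lyndon u" if "u \<in> set (map row (rev cycle_mins))" for u
    using that strictly_minimal_row row_nonempty by (auto intro!: lyndon_if_strictly_minimal)
  have "ord_class.lexordp_eq (row i) (row j)"
    if "i \<in> set cycle_mins" "j \<in> set cycle_mins" "i < j" for i j
  proof -
    have "i < n" "j < n" using that by (auto simp: cycle_mins_def)
    then show ?thesis
      using trace_mono[OF that(3)] row_eq_if_trace_eq[of i j] strictly_minimal_row[OF that(1)]
        lexordp_eq_if_less_fun_inf_power[OF row_nonempty row_nonempty, of i j]
      by (auto simp: inf_power_row lexordp_eq_refl)
  qed
  moreover have "sorted_wrt (<) cycle_mins" by (simp add: cycle_mins_def sorted_wrt_filter)
  ultimately have "sorted_wrt (\<lambda>i j. ord_class.lexordp_eq (row i) (row j)) cycle_mins"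
    by (auto intro: sorted_wrt_mono_rel[rotated])
  then show "sorted_wrt (\<lambda>x y. ord_class.lexordp_eq y x) (map row (rev cycle_mins))"
    by (simp add: sorted_wrt_map sorted_wrt_rev)
qed

text \<open>The rotations of a factor are the rows along its cycle, and the cycles together contain
  each index exactly once.\<close>

lemma lyndon_rotations_cycles: "lyndon_rotations (map L (concat cycles)) = mset (map row [0..<n])"
proof -
  have "map (\<lambda>k. rotate k (row i)) [0..<length (row i)] = map row (support \<sigma> i)" for i
    by (simp add: rotate_row length_row comp_def)
  then have "lyndon_rotations (map L (concat cycles)) =
      mset (concat (map (map row \<circ> support \<sigma>) (rev cycle_mins)))"
    unfolding lyndon_rotations_def lyndon_factorization_eqI[OF is_lyndon_factorization_rows]
    by (simp add: comp_def)
  also have "concat (map (map row \<circ> support \<sigma>) (rev cycle_mins)) = map row (concat cycles)"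
    by (simp add: cycles_def map_concat)
  also have "mset (map row (concat cycles)) = mset (map row [0..<n])"
    by (simp only: mset_map mset_concat_cycles)
  finally show ?thesis .
qed

lemma bbwt_cycles: "bbwt (map L (concat cycles)) = map (\<lambda>i. last (row i)) [0..<n]"
  using bbwt_eqI[OF lyndon_rotations_cycles[symmetric] sorted_rows] by (simp add: comp_def)

end

section \<open>Preimages under the transform\<close>

lemma sorted_prefix_remainder:
  fixes s :: "'a::linorder list"
  assumes "sorted s" "mset (take r s @ R) = mset s"
  shows "mset R = mset (drop r s)" "x \<in> set (take r s) \<Longrightarrow> z \<in> set R \<Longrightarrow> x \<le> z"
proof -
  have "mset (take r s) + mset R = mset (take r s) + mset (drop r s)"
    using assms(2) by (metis append_take_drop_id mset_append)
  then show R: "mset R = mset (drop r s)" by simp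
  then have "set R = set (drop r s)" by (metis mset_eq_setD)
  then show "x \<le> z" if "x \<in> set (take r s)" "z \<in> set R"
    using that assms(1) sorted_append[of "take r s" "drop r s"] by simp
qed

text \<open>The word \<open>w\<close> is spelled by the cycles of the standard permutation of
  \<open>P\<close>. The cycle of 0 comes last and starts with \<open>0, ..., r\<close>, which spells
  the sorted prefix of length \<open>Suc r\<close>.\<close>

lemma bbwt_preimage:
  fixes P :: "'a::linorder list"
  assumes P: "P = y # take r (sort P) @ R" and r: "r < length P"
    and y: "\<And>x. x \<in> set (take r (sort P)) \<Longrightarrow> x < y"
  obtains w X Y where "bbwt w = P" "mset w = mset P" "w = X @ take (Suc r) (sort P) @ Y"
proof -
  define n where "n = length P"
  define f where "f = (\<lambda>i. (P ! i, i))"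
  define less where "less = (\<lambda>i j. P ! i < P ! j \<or> P ! i = P ! j \<and> i < j)"
  \<comment> \<open>Position 0 and the positions behind the copied prefix, by letter and then by
    position. Placed after \<open>1, ..., r\<close>, they complete the stable sort \<open>q\<close>
    of all positions.\<close>
  define rest where "rest = sort_key f (0 # [Suc r..<n])"
  have set_rest: "set rest = insert 0 {Suc r..<n}" and dist_rest: "distinct rest"
    and len_rest: "length rest = Suc (n - Suc r)" and sorted_rest: "sorted (map f rest)"
    unfolding rest_def set_sort distinct_sort length_sort
    by (auto simp del: sort_key_simps intro: sorted_sort_key)
  define q where "q = [1..<Suc r] @ rest"
  define a where "a = take r (sort P)"
  have Pa: "P = y # a @ R" and len: "length a = r" using P r by (simp_all add: a_def)
  have nth_low: "P ! i \<in> set a" "P ! i = sort P ! (i - 1)" if i: "i \<in> {1..<Suc r}" for i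
  proof -
    have lt: "i - 1 < r" using i by auto
    then have "P ! i = a ! (i - 1)"
      using i len unfolding Pa by (simp add: nth_append nth_Cons')
    then show "P ! i \<in> set a" "P ! i = sort P ! (i - 1)"
      using lt len nth_mem[of "i - 1" a] by (simp_all add: a_def)
  qed
  have nth_high: "P ! i \<in> set R" if i: "i \<in> {Suc r..<n}" for i
  proof -
    have "\<not> i - 1 < r" using i by auto
    then have "P ! i = R ! (i - Suc r)"
      using i len unfolding Pa by (simp add: nth_append nth_Cons')
    moreover have "n = Suc (r + length R)" unfolding n_def Pa by (simp add: len)
    ultimately show ?thesis using i nth_mem[of "i - Suc r" R] by auto
  qed
  have mset_R: "mset (a @ (R @ [y])) = mset (sort P)"
    unfolding mset_sort unfolding Pa by simp
  have "r < n" using r by (simp add: n_def)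
  then have set_q: "set q = {..<n}" by (auto simp: q_def set_rest)
  have dist_q: "distinct q" using dist_rest by (auto simp: q_def set_rest)
  have len_q: "length q = n" using \<open>r < n\<close> unfolding q_def length_append len_rest length_upt by linarith
  have "sorted_wrt less q"
    unfolding q_def sorted_wrt_append
  proof (intro conjI ballI)
    have low: "less i j" if "i \<in> {1..<Suc r}" "j \<in> {1..<Suc r}" "i < j" for i j
    proof -
      have "i - 1 \<le> j - 1" "j - 1 < length (sort P)" using that r by auto
      with sorted_sort have "sort P ! (i - 1) \<le> sort P ! (j - 1)" by (rule sorted_nth_mono)
      then show ?thesis
        using that(3) nth_low(2)[OF that(1)] nth_low(2)[OF that(2)] unfolding less_def by (metis order_le_less)
    qed
    show "sorted_wrt less [1..<Suc r]"
      by (rule sorted_wrt_mono_rel[OF _ sorted_wrt_upt]) (use low in \<open>simp only: set_upt\<close>)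
    have "sorted_wrt (\<lambda>i j. f i \<le> f j) rest" using sorted_rest by (simp add: sorted_map)
    then have "sorted_wrt (\<lambda>i j. f i \<le> f j \<and> i \<noteq> j) rest"
      using dist_rest by (auto simp: sorted_wrt_iff_nth_less nth_eq_iff_index_eq)
    then show "sorted_wrt less rest"
      by (rule sorted_wrt_mono_rel[rotated]) (auto simp: f_def less_def)
    fix i j assume "i \<in> set [1..<Suc r]" "j \<in> set rest"
    then have i: "i \<in> {1..<Suc r}" and "j = 0 \<or> j \<in> {Suc r..<n}" by (auto simp: set_rest)
    then show "less i j"
    proof (elim disjE)
      \<comment> \<open>Position 0 precedes \<open>i\<close>, so a tie would put it first; the
        strict bound on \<open>y\<close> excludes this.\<close>
      assume "j = 0"
      then show ?thesis using y nth_low(1)[OF i] by (simp add: less_def a_def[symmetric]) (simp add: Pa)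
    next
      assume j: "j \<in> {Suc r..<n}"
      then have "P ! i \<le> P ! j"
        using sorted_prefix_remainder(2)[OF sorted_sort mset_R[unfolded a_def]] nth_low(1)[OF i] nth_high
        by (simp add: a_def)
      then show ?thesis using i j by (auto simp: less_def)
    qed
  qed
  then have less_q: "less (q ! i) (q ! j)" if "i < j" "j < n" for i j
    using that unfolding len_q[symmetric] by (rule sorted_wrt_nth_less)
  define L where "L = (\<lambda>j. P ! (q ! j))"
  define \<sigma> where "\<sigma> = (\<lambda>j. if j < n then q ! j else j)"
  have perm: "\<sigma> permutes {..<n}"
  proof (rule bij_imp_permutes)
    have "bij_betw ((!) q) {..<n} {..<n}"
      by (rule bij_betw_nth[OF dist_q]) (simp_all only: len_q set_q)
    moreover have "\<sigma> i = q ! i" if "i \<in> {..<n}" for i using that by (simp add: \<sigma>_def)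
    ultimately show "bij_betw \<sigma> {..<n} {..<n}"
      using bij_betw_cong[of "{..<n}" \<sigma> "(!) q" "{..<n}"] by blast
  qed (simp add: \<sigma>_def)
  interpret stable_permutation n L \<sigma>
  proof
    show "\<sigma> permutes {..<n}" by (rule perm)
    show "L i \<le> L j" if "i \<le> j" "j < n" for i j
      using less_q[of i j] that by (cases "i = j") (auto simp: L_def less_def)
    show "\<sigma> i < \<sigma> j" if "i < j" "j < n" "L i = L j" for i j
      using less_q[of i j] that by (auto simp: L_def less_def \<sigma>_def)
  qed
  define w where "w = map L (concat cycles)"
  have map_L: "map L [0..<n] = sort P"
  proof (rule properties_for_sort[symmetric])
    have "map L [0..<n] = map ((!) P) q"
      using len_q by (auto simp: L_def intro: nth_equalityI)
    moreover have "mset q = mset [0..<n]"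
      using dist_q set_q by (metis atLeast0LessThan distinct_upt set_eq_iff_mset_eq_distinct set_upt)
    ultimately have "mset (map L [0..<n]) = mset (map ((!) P) [0..<n])" by simp
    then show "mset (map L [0..<n]) = mset P" by (simp add: n_def map_nth)
    show "sorted (map L [0..<n])"
      by (simp add: sorted_iff_nth_mono mono)
  qed
  have "mset w = mset P"
    unfolding w_def mset_map mset_concat_cycles using map_L by (metis mset_map mset_sort)
  moreover have "bbwt w = P"
    unfolding w_def bbwt_cycles
  proof (rule nth_equalityI)
    fix i assume "i < length (map (\<lambda>i. last (row i)) [0..<n])"
    then have i: "i < n" by simp
    then obtain j where j: "j < n" "q ! j = i" using set_q len_q by (metis in_set_conv_nth lessThan_iff)
    then have "last (row i) = L j" using last_row[of j] by (simp add: \<sigma>_def)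
    then show "map (\<lambda>i. last (row i)) [0..<n] ! i = P ! i" using i j by (simp add: L_def)
  qed (simp add: n_def)
  moreover have "\<exists>X Y. w = X @ take (Suc r) (sort P) @ Y"
  proof -
    have "0 < n" using \<open>r < n\<close> by simp
    \<comment> \<open>Entry \<open>j\<close> of \<open>q\<close> is \<open>j + 1\<close> for
      \<open>j < r\<close>.\<close>
    have start: "(\<sigma> ^^ j) 0 = j" if "j \<le> r" for j
      using that
    proof (induction j)
      case (Suc j)
      then show ?case using \<open>r < n\<close> by (simp add: \<sigma>_def q_def nth_append del: upt_Suc)
    qed simp
    \<comment> \<open>A return to 0 within \<open>r\<close> steps would contradict
      \<open>start\<close>.\<close>
    have "r < least_power \<sigma> 0"
      using start[of "least_power \<sigma> 0"] least_power_of_permutation[OF permutation, of 0] by linarith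
    then have split: "[0..<least_power \<sigma> 0] = [0..<Suc r] @ [Suc r..<least_power \<sigma> 0]"
      using upt_add_eq_append[of 0 "Suc r" "least_power \<sigma> 0 - Suc r"] by (simp del: upt_Suc)
    have "map (\<lambda>j. (\<sigma> ^^ j) 0) [0..<Suc r] = [0..<Suc r]"
      by (rule map_idI) (use start in auto)
    moreover have "map L [0..<Suc r] = take (Suc r) (sort P)"
      unfolding map_L[symmetric] take_map using \<open>r < n\<close> by (simp del: upt_Suc)
    ultimately have row: "row 0 = take (Suc r) (sort P) @
        map L (map (\<lambda>j. (\<sigma> ^^ j) 0) [Suc r..<least_power \<sigma> 0])"
      by (simp only: row_def split map_append)
    obtain ms where "cycle_mins = 0 # ms"
      using \<open>0 < n\<close> by (simp add: cycle_mins_def upt_conv_Cons)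
    then have "w = map L (concat (map (support \<sigma>) (rev ms))) @ row 0"
      by (simp add: w_def cycles_def row_def)
    then show ?thesis using row by metis
  qed
  ultimately show thesis using that by blast
qed

text \<open>The case \<open>r = 0\<close>, where the copied prefix is empty and any first letter
  will do.\<close>

lemma bbwt_surj:
  assumes "P \<noteq> []"
  shows "\<exists>w. bbwt w = P \<and> mset w = mset P"
proof -
  obtain y R where P: "P = y # take 0 (sort P) @ R" using assms by (cases P) simp_all
  show ?thesis
  proof (rule bbwt_preimage[OF P])
    show "0 < length P" using assms by simp
  qed auto
qed

section \<open>Reversibility of the operations\<close>

text \<open>Finiteness turns \<open>S \<subseteq> g\<close>
  S\<open>into injectivity on\<close>S\<open>and\<close>g \<open>S = S\<close>. In this way
  surjectivity of the transform also shows that it preserves the letters.\<close>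

lemma funpow_return:
  assumes "finite S" "\<And>P. P \<in> S \<Longrightarrow> \<exists>w\<in>S. g w = P" "w \<in> S"
  shows "g w \<in> S" "\<exists>k. (g ^^ k) (g w) = w"
proof -
  have sub: "S \<subseteq> g ` S" using assms(2) by blast
  then have inj: "inj_on g S" by (rule finite_surj_inj[OF assms(1)])
  then have im: "g ` S = S" using sub assms(1) by (metis card_image card_subset_eq finite_imageI)
  then show "g w \<in> S" using assms(3) by blast
  \<comment> \<open>Extending \<open>g\<close> by the identity outside \<open>S\<close> gives a
    permutation, which has finite order.\<close>
  define h where "h = (\<lambda>x. if x \<in> S then g x else x)"
  have "h permutes S"
  proof (rule bij_imp_permutes)
    show "bij_betw h S S"
      using inj im by (auto simp: bij_betw_def h_def inj_on_def)
  qed (simp add: h_def)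
  then have "permutation h" using assms(1) by (auto simp: permutation_permutes)
  then obtain n where n: "h ^^ n = id" "n > 0" by (rule permutation_is_nilpotent)
  have gh: "(h ^^ k) x = (g ^^ k) x \<and> (g ^^ k) x \<in> S" if "x \<in> S" for k x
    using that im by (induction k) (auto simp: h_def)
  obtain k where "n = Suc k" using n(2) gr0_implies_Suc by blast
  then have "(h ^^ k) (h w) = w" using n(1) by (metis comp_apply funpow_Suc_right id_apply)
  then show "\<exists>k. (g ^^ k) (g w) = w" using gh assms(3) \<open>g w \<in> S\<close> by (metis h_def)
qed

abbreviation reach :: "'a::linorder list \<Rightarrow> 'a list \<Rightarrow> bool" where
  "reach \<equiv> (\<lambda>x y. y = rot x \<or> y = bbwt x)\<^sup>*\<^sup>*"

lemma reach_rotate: "reach (x @ y) (y @ x)"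
proof (induction y arbitrary: x rule: rev_induct)
  case (snoc a y)
  have "reach (x @ y @ [a]) (a # x @ y)"
    by (rule r_into_rtranclp) (simp add: rot_def butlast_append)
  moreover have "reach ((a # x) @ y) (y @ a # x)" by (rule snoc.IH)
  ultimately show ?case by (auto intro: rtranclp_trans)
qed simp

lemma reach_bbwt: "reach x (bbwt x)"
  by (rule r_into_rtranclp) simp

lemma reach_funpow:
  assumes "\<And>x. reach x (g x)"
  shows "reach x ((g ^^ k) x)"
  by (induction k) (auto intro: rtranclp_trans assms)

text \<open>Each single step is undone by iterating the same operation on the finite set of words
  with the letters of \<open>u\<close>.\<close>

lemma reach_sym:
  assumes "reach u v" "u \<noteq> []"
  shows "reach v u \<and> mset v = mset u"
  using assms(1)
proof (induction rule: rtranclp_induct)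
  case (step x y)
  define S where "S = {w. mset w = mset u}"
  have fin: "finite S" by (simp add: S_def mset_eq_finite)
  have "x \<in> S" using step by (simp add: S_def)
  have nonempty: "P \<noteq> []" if "P \<in> S" for P using that assms(2) by (auto simp: S_def)
  have bbwt: "\<exists>w\<in>S. bbwt w = P" if "P \<in> S" for P
    using bbwt_surj[OF nonempty[OF that]] that by (auto simp: S_def)
  have rot: "\<exists>w\<in>S. rot w = P" if "P \<in> S" for P
    using nonempty[OF that] that
    by (intro bexI[of _ "tl P @ [hd P]"]) (cases P; simp add: S_def rot_def)+
  have return: "g x \<in> S \<and> reach (g x) x"
    if surj: "\<And>P. P \<in> S \<Longrightarrow> \<exists>w\<in>S. g w = P" and step: "\<And>w. reach w (g w)" for g
  proof -
    obtain k where "(g ^^ k) (g x) = x"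
      using funpow_return(2)[OF fin surj \<open>x \<in> S\<close>] by blast
    moreover have "reach (g x) ((g ^^ k) (g x))" by (rule reach_funpow[OF step])
    ultimately show ?thesis using funpow_return(1)[OF fin surj \<open>x \<in> S\<close>] by simp
  qed
  have "reach w (rot w)" for w :: "'a list" by (rule r_into_rtranclp) simp
  then have "y \<in> S \<and> reach y x"
    using step.hyps(2) return[OF rot] return[OF bbwt reach_bbwt] by blast
  then show ?case using step.IH by (auto simp: S_def intro: rtranclp_trans)
qed simp

section \<open>Reaching every word from the sorted word\<close>

lemma reach_from_sorted:
  fixes s :: "'a::linorder list"
  assumes "sorted s" "distinct s \<or> (\<exists>A. card A = 2 \<and> set s \<subseteq> A)" "mset (take r s @ R) = mset s"
  shows "reach s (take r s @ R)"
  using assms(3)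
proof (induction "length s - r" arbitrary: r R rule: less_induct)
  case less
  note rem = sorted_prefix_remainder[OF assms(1) less.prems]
  show ?case
  proof (cases "r < length s")
    case False
    then show ?thesis using less.prems by simp
  next
    case True
    have "length R = length s - r" using rem(1) by (metis length_drop mset_eq_length)
    then obtain R' y where R: "R = R' @ [y]" using True by (cases R rule: rev_cases) auto
    have IH: "reach s (take (Suc r) s @ Q)" if "mset (take (Suc r) s @ Q) = mset s" for Q
      using that True by (intro less.hyps) auto
    have rotate: "reach s (take r s @ R)" if "reach s (y # take r s @ R')"
      using that reach_rotate[of "[y]" "take r s @ R'"] R by (auto intro: rtranclp_trans)
    show ?thesis
    proof (cases "\<forall>x\<in>set (take r s). x < y")
      case greater: True
      define P where "P = y # take r s @ R'"
      have "mset P = mset s" using less.prems R by (simp add: P_def)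
      then have s: "sort P = s" using assms(1) by (intro properties_for_sort) simp_all
      have "r < length P" using True \<open>mset P = mset s\<close> by (metis mset_eq_length)
      then obtain w X Y where w: "bbwt w = P" "mset w = mset P" "w = X @ take (Suc r) s @ Y"
        using bbwt_preimage[of P y r R'] greater s by (auto simp: P_def)
      \<comment> \<open>The rotation of the preimage \<open>w\<close> that starts with the longer
        prefix is covered by induction; from it the path goes through \<open>w\<close> to
        \<open>P\<close>.\<close>
      have "reach s (take (Suc r) s @ Y @ X)" using w \<open>mset P = mset s\<close> by (intro IH) (simp add: ac_simps)
      moreover have "reach (take (Suc r) s @ Y @ X) w"
        using reach_rotate[of "take (Suc r) s @ Y" X] w(3) by simp
      moreover have "reach w P" using reach_bbwt[of w] w(1) by simp
      ultimately have "reach s P" by (meson rtranclp_trans)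
      then show ?thesis using rotate by (simp add: P_def)
    next
      case False
      then obtain x where x: "x \<in> set (take r s)" "y \<le> x" by auto
      \<comment> \<open>Letters of the remainder are at least those of the prefix, so
        \<open>y\<close> occurs on both sides of the cut of \<open>s\<close>. This repetition leaves
        only the binary case.\<close>
      then have "y = x" using rem(2)[of x y] R by auto
      have y: "y \<in> set (take r s)" "y \<in> set (drop r s)"
        using x \<open>y = x\<close> R mset_eq_setD[OF rem(1)] by auto
      then have "\<not> distinct s" by (metis append_take_drop_id disjoint_iff distinct_append)
      then obtain a b where ab: "set s \<subseteq> {a, b}" "a < b"
        using assms(2) by (auto simp: card_2_iff) (metis insert_commute linorder_neqE)
      have sets: "set (take r s) \<subseteq> {a, b}" "set (drop r s) \<subseteq> {a, b}"
        using ab(1) set_take_subset set_drop_subset by fast+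
      have le: "x \<le> z" if "x \<in> set (take r s)" "z \<in> set (drop r s)" for x z
        using that assms(1) sorted_append[of "take r s" "drop r s"] by simp
      consider "y = a" | "y = b" using y sets by blast
      then show ?thesis
      proof cases
        case 1
        then have "set (take r s) \<subseteq> {y}" using le[OF _ y(2)] sets(1) ab(2) by fastforce
        then have a: "take r s = replicate r y"
          using True by (auto intro!: replicate_eqI)
        have "drop r s = s ! r # drop (Suc r) s" using True by (simp add: Cons_nth_drop_Suc)
        moreover have "sorted (drop r s)" using assms(1) by (simp add: sorted_wrt_drop)
        \<comment> \<open>The smaller letter fills the prefix and still occurs behind it, so
          \<open>s ! r\<close> is also \<open>y\<close>, and \<open>y\<close> followed by the prefix
          is the longer prefix.\<close>
        ultimately have "s ! r \<le> y" "s ! r \<in> {a, b}" using y(2) sets(2) by auto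
        then have "s ! r = y" using 1 ab(2) by auto
        then have "take (Suc r) s = y # take r s"
          using True by (simp add: take_Suc_conv_app_nth a replicate_append_same)
        then show ?thesis using IH[of R'] rotate less.prems R by simp
      next
        case 2
        \<comment> \<open>The larger letter already occurs in the prefix, so nothing else follows it
          and the word is \<open>s\<close> itself.\<close>
        then have "set (drop r s) \<subseteq> {y}" using le[OF y(1)] sets(2) ab(2) by fastforce
        moreover from this have "set R \<subseteq> {y}" using rem(1) by (metis mset_eq_setD)
        ultimately have "R = drop r s"
          using \<open>length R = length s - r\<close> by (metis length_drop replicate_eqI singletonD subsetD)
        then show ?thesis by simp
      qed
    qed
  qed
qed

theorem theorem4:
  fixes u v :: "'a::linorder list"
  assumes "length u = length v"
    and "parikh u = parikh v"
    and "distinct u \<or> (\<exists>A. card A = 2 \<and> set u \<subseteq> A \<and> set v \<subseteq> A)"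
  shows "(\<lambda>x y. y = rot x \<or> y = bbwt x)\<^sup>*\<^sup>* u v"
proof (cases "u = []")
  case True
  then show ?thesis using assms(1) by simp
next
  case False
  have uv: "mset u = mset v"
    using assms(2) by (intro multiset_eqI) (simp add: parikh_def count_mset fun_eq_iff)
  define s where "s = sort u"
  have s: "distinct s \<or> (\<exists>A. card A = 2 \<and> set s \<subseteq> A)"
    using assms(3) by (auto simp: s_def)
  \<comment> \<open>With the empty prefix every arrangement of the letters is reached from
    \<open>s\<close>; the path to \<open>u\<close> is then reversed.\<close>
  have "reach s u" "reach s v"
    using reach_from_sorted[of s 0] s uv by (auto simp: s_def)
  moreover have "s \<noteq> []" using False by (metis s_def mset_sort mset_zero_iff)
  ultimately show ?thesis using reach_sym[of s u] by (meson rtranclp_trans)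
qed

end
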